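(* Suppose that $A\in\mathbb{R}^{m\times n}$ has rank $r$. Consider the linear program in the variables $H^+,H^-\in\mathbb{R}^{n\times m}$ $$\begin{array}{ll}\min & \langle J,H^+\rangle + \langle J,H^-\rangle\\ \text{s.t.} & A(H^+-H^-)A = A,\\ & \big(A(H^+-H^-)\big)^\top = A(H^+-H^-),\\ & \big((H^+-H^-)A\big)^\top = (H^+-H^-)A,\\ & H^+\ge 0,\ H^-\ge 0,\end{array}$$ which is the standard linear-programming reformulation of the problem $\min_{H\in\mathbb{R}^{n\times m}}\{\|H\|_1 : AHA=A,\ (AH)^\top=AH,\ (HA)^\top=HA\}$. Then every extreme solution $(H^+,H^-)$ of this linear program has at most $$mn-(m-r)(n-r)$$ nonzeros.
   Context: $J$ is the all-ones $n\times m$ matrix, $\langle\cdot,\cdot\rangle$ is the Frobenius inner product, $\|H\|_1$ is the sum of the absolute values of the entries of $H$, and inequalities between matrices are entrywise. An extreme solution is an extreme point of the feasible region of the linear program (a basic feasible solution), and its number of nonzeros is the total number of nonzero entries among the entries of $H^+$ and $H^-$. *)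

theory Defs
  imports "HOL-Analysis.Analysis"
begin

text \<open>The type \<open>real ^ 'n ^ 'm\<close> is the type of m x n matrices, with \<open>m = CARD('m)\<close> rows
  and \<open>n = CARD('n)\<close> columns. The order on it is entrywise, and its inner product is the
  Frobenius inner product.\<close>

definition lp_feasible :: "real ^ 'n ^ 'm \<Rightarrow> ((real ^ 'm ^ 'n) \<times> (real ^ 'm ^ 'n)) set" where
  "lp_feasible A = {(Hp, Hm).
     A ** (Hp - Hm) ** A = A \<and>
     transpose (A ** (Hp - Hm)) = A ** (Hp - Hm) \<and>
     transpose ((Hp - Hm) ** A) = (Hp - Hm) ** A \<and>
     0 \<le> Hp \<and> 0 \<le> Hm}"

text \<open>The objective to be minimised. It completes the linear program, but being an extreme
  point of the feasible region does not depend on it (extreme solutions need not be optimal).\<close>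

definition lp_objective :: "(real ^ 'm ^ 'n) \<times> (real ^ 'm ^ 'n) \<Rightarrow> real" where
  "lp_objective = (\<lambda>(Hp, Hm). (\<chi> i j. 1) \<bullet> Hp + (\<chi> i j. 1) \<bullet> Hm)"

definition lp_extreme_solution ::
  "real ^ 'n ^ 'm \<Rightarrow> (real ^ 'm ^ 'n) \<times> (real ^ 'm ^ 'n) \<Rightarrow> bool" where
  "lp_extreme_solution A H \<longleftrightarrow> H extreme_point_of lp_feasible A"

definition nnz :: "real ^ 'b ^ 'a \<Rightarrow> nat" where
  "nnz M = card {(i, j). M $ i $ j \<noteq> 0}"

end

theory Submission
  imports Defs
begin

text \<open>Write \<open>H = Hp - Hm\<close>. All constraints other than the sign constraints see \<open>H\<close> only through
  \<open>A H\<close> and \<open>H A\<close>, so they are insensitive to moving \<open>H\<close> along the subspace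
  \<open>K = {D. A D = 0, D A = 0}\<close>. The sign constraints leave room for a small move, forwards and
  backwards, of every entry that is nonzero. Hence at an extreme solution no nonzero move is
  possible that changes only nonzero entries of \<open>Hp\<close> and \<open>Hm\<close> and changes \<open>H\<close> by an element of \<open>K\<close>
  (\<open>lp_extreme_solution_no_direction\<close>).

  This has two consequences. First, \<open>Hp\<close> and \<open>Hm\<close> have disjoint supports, since equal moves of an
  entry of both leave \<open>H\<close> unchanged; so the number \<open>s\<close> of nonzeros is the size of the union
  \<open>S\<close> of the supports. Second, the \<open>s\<close>-dimensional space of matrices supported on \<open>S\<close> meets \<open>K\<close>
  only in \<open>0\<close>, which forces \<open>s + dim K \<le> m n\<close>.

  It remains to see that \<open>dim K \<ge> (m - r) (n - r)\<close> (\<open>dim_two_sided_kernel\<close>). The space \<open>K\<close> contains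
  \<open>u v\<^sup>T\<close> for each \<open>u\<close> in the kernel of \<open>A\<close>, of dimension \<open>n - r\<close>, and each \<open>v\<close> in the kernel of
  \<open>A\<^sup>T\<close>, of dimension \<open>m - r\<close>, and the products of two orthonormal bases
  are independent (\<open>dim_outer_products\<close>).\<close>

section \<open>The two-sided null space of a matrix\<close>

text \<open>The kernel is the orthogonal complement of the row space, whose dimension is the rank.\<close>

lemma dim_kernel_add_rank:
  fixes A :: "real ^ 'n ^ 'm"
  shows "dim {x. A *v x = 0} + rank A = CARD('n)"
proof -
  have "A *v x = 0" if "\<forall>y \<in> span (rows A). orthogonal y x" for x
  proof -
    have "row i A \<bullet> x = 0" for i
      using that span_base[of "row i A" "rows A"] by (auto simp: rows_def orthogonal_def)
    then show ?thesis
      by (simp add: vec_eq_iff matrix_mult_dot row_def vec_nth_inverse)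
  qed
  then have "{x. A *v x = 0} = {x \<in> UNIV. \<forall>y \<in> span (rows A). orthogonal y x}"
    using orthogonal_nullspace_rowspace[of A] by (auto simp: orthogonal_commute)
  then show ?thesis
    using dim_subspace_orthogonal_to_vectors[of "span (rows A)" UNIV]
    by (simp add: row_rank_def)
qed

definition outer :: "real ^ 'n \<Rightarrow> real ^ 'm \<Rightarrow> real ^ 'm ^ 'n" where
  "outer u v = (\<chi> i j. u $ i * v $ j)"

lemma inner_outer: "outer u v \<bullet> outer u' v' = (u \<bullet> u') * (v \<bullet> v')"
  unfolding outer_def inner_vec_def sum_product by (simp add: mult_ac)

lemma matrix_mul_outer: "A ** outer u v = outer (A *v u) v"
  unfolding outer_def matrix_matrix_mult_def matrix_vector_mult_def vec_eq_iff
  by (simp add: sum_distrib_right mult.assoc)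

lemma outer_matrix_mul: "outer u v ** A = outer u (v v* A)"
  unfolding outer_def matrix_matrix_mult_def vector_matrix_mult_def vec_eq_iff
  by (simp add: sum_distrib_left mult_ac)

lemma outer_zero [simp]: "outer 0 v = 0" "outer u 0 = 0"
  by (simp_all add: outer_def vec_eq_iff)

text \<open>This is the bound \<open>dim (U \<otimes> V) \<ge> dim U * dim V\<close>: the outer products of two orthonormal
  bases are again orthonormal for the Frobenius inner product, hence independent.\<close>

lemma dim_outer_products:
  fixes W :: "(real ^ 'm ^ 'n) set"
  assumes U: "subspace U" and V: "subspace V"
    and W: "\<And>u v. u \<in> U \<Longrightarrow> v \<in> V \<Longrightarrow> outer u v \<in> W"
  shows "dim U * dim V \<le> dim W"
proof -
  obtain B where B: "B \<subseteq> U" "pairwise orthogonal B" "\<And>x. x \<in> B \<Longrightarrow> norm x = 1" "card B = dim U"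
    using orthonormal_basis_subspace[OF U] by metis
  obtain C where C: "C \<subseteq> V" "pairwise orthogonal C" "\<And>x. x \<in> C \<Longrightarrow> norm x = 1" "card C = dim V"
    using orthonormal_basis_subspace[OF V] by metis
  let ?f = "\<lambda>(u, v). outer u v"
  have gram: "?f p \<bullet> ?f q = (if p = q then 1 else 0)" if "p \<in> B \<times> C" "q \<in> B \<times> C" for p q
    using that B(2,3) C(2,3)
    by (auto simp: inner_outer pairwise_def orthogonal_def norm_eq_1 split: prod.splits)
  then have inj: "inj_on ?f (B \<times> C)"
    unfolding inj_on_def by (metis zero_neq_one)
  have "independent (?f ` (B \<times> C))"
  proof (rule pairwise_orthogonal_independent)
    show "pairwise orthogonal (?f ` (B \<times> C))"
      unfolding pairwise_def orthogonal_def
    proof (intro ballI impI)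
      fix x y assume "x \<in> ?f ` (B \<times> C)" "y \<in> ?f ` (B \<times> C)" "x \<noteq> y"
      then obtain p q where "p \<in> B \<times> C" "q \<in> B \<times> C" "x = ?f p" "y = ?f q" "p \<noteq> q"
        by blast
      then show "x \<bullet> y = 0" using gram by simp
    qed
    show "0 \<notin> ?f ` (B \<times> C)"
    proof
      assume "0 \<in> ?f ` (B \<times> C)"
      then obtain p where "p \<in> B \<times> C" "?f p = 0" by force
      then show False using gram[of p p] by simp
    qed
  qed
  moreover have "?f ` (B \<times> C) \<subseteq> W" using B(1) C(1) W by auto
  ultimately have "card (?f ` (B \<times> C)) \<le> dim W"
    by (metis dim_eq_card_independent dim_subset)
  then show ?thesis
    by (simp add: card_image[OF inj] card_cartesian_product B(4) C(4))
qed

lemma add_matrix_mul_distrib: "(B + C) ** A = B ** A + C ** (A :: 'a::semiring_1 ^ 'n ^ 'm)"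
  by (simp add: matrix_matrix_mult_def vec_eq_iff distrib_right sum.distrib)

definition two_sided_kernel :: "real ^ 'n ^ 'm \<Rightarrow> (real ^ 'm ^ 'n) set" where
  "two_sided_kernel A = {D. A ** D = 0 \<and> D ** A = 0}"

lemma subspace_two_sided_kernel: "subspace (two_sided_kernel A)"
  by (auto simp: two_sided_kernel_def subspace_def matrix_add_ldistrib add_matrix_mul_distrib
      matrix_scalar_ac simp flip: scalar_matrix_assoc)

text \<open>If \<open>A u = 0\<close> and \<open>v\<^sup>T A = 0\<close>, then \<open>u v\<^sup>T\<close> is annihilated by \<open>A\<close> on both sides.\<close>

lemma dim_two_sided_kernel:
  fixes A :: "real ^ 'n ^ 'm"
  shows "(CARD('n) - rank A) * (CARD('m) - rank A) \<le> dim (two_sided_kernel A)"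
proof -
  have "dim {u. A *v u = 0} * dim {v. transpose A *v v = 0} \<le> dim (two_sided_kernel A)"
    by (intro dim_outer_products)
      (auto simp: two_sided_kernel_def matrix_mul_outer outer_matrix_mul subspace_def
        matrix_vector_right_distrib matrix_vector_mult_scaleR simp del: transpose_matrix_vector
        simp flip: transpose_matrix_vector)
  moreover have "dim {u. A *v u = 0} = CARD('n) - rank A"
    using dim_kernel_add_rank[of A] by linarith
  moreover have "dim {v. transpose A *v v = 0} = CARD('m) - rank A"
    using dim_kernel_add_rank[of "transpose A"] by (simp only: rank_transpose)
  ultimately show ?thesis by simp
qed

section \<open>Supports of extreme solutions\<close>

lemma extreme_point_of_symmetric_perturbation:
  assumes "x extreme_point_of S" "x + d \<in> S" "x - d \<in> S"
  shows "d = 0"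
proof (rule ccontr)
  assume "d \<noteq> 0"
  then have "x - d \<noteq> x + d"
    by (metis add.commute add_right_cancel diff_add_cancel add_cancel_right_right
        double_eq_0_iff add.assoc scaleR_2 scaleR_eq_0_iff zero_neq_numeral)
  moreover have "x = midpoint (x - d) (x + d)"
    by (simp add: midpoint_def flip: scaleR_2)
  ultimately have "x \<in> open_segment (x - d) (x + d)"
    by (metis midpoint_in_open_segment)
  then show False
    using assms by (auto simp: extreme_point_of_def)
qed

definition support :: "real ^ 'b ^ 'a \<Rightarrow> ('a \<times> 'b) set" where
  "support M = {(i, j). M $ i $ j \<noteq> 0}"

lemma matrix_nonneg_iff: "(0 :: real ^ 'b ^ 'a) \<le> M \<longleftrightarrow> (\<forall>i j. 0 \<le> M $ i $ j)"
  by (simp add: less_eq_vec_def)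

text \<open>There are finitely many entries, so the least of the ratios \<open>P\<^sub>i\<^sub>j / \<bar>D\<^sub>i\<^sub>j\<bar>\<close> over the support of
  \<open>D\<close> bounds the step length away from \<open>0\<close>.\<close>

lemma ex_nonneg_perturbation:
  fixes P D :: "real ^ 'b ^ 'a"
  assumes P: "0 \<le> P" and D: "support D \<subseteq> support P"
  obtains e where "0 < e" "\<And>c. \<bar>c\<bar> \<le> e \<Longrightarrow> 0 \<le> P + c *\<^sub>R D"
proof -
  \<comment> \<open>The inserted \<open>1\<close> keeps the minimum meaningful when \<open>D = 0\<close>.\<close>
  let ?E = "insert 1 ((\<lambda>(i, j). P $ i $ j / \<bar>D $ i $ j\<bar>) ` support D)"
  have fin: "finite ?E" by simp
  have pos: "0 < P $ i $ j" if "D $ i $ j \<noteq> 0" for i j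
    using that D P by (force simp: support_def matrix_nonneg_iff less_le)
  have "0 < Min ?E"
    using pos by (subst Min_gr_iff[OF fin]) (auto simp: support_def)
  moreover have "0 \<le> P + c *\<^sub>R D" if c: "\<bar>c\<bar> \<le> Min ?E" for c
    unfolding matrix_nonneg_iff
  proof (intro allI)
    fix i j
    show "0 \<le> (P + c *\<^sub>R D) $ i $ j"
    proof (cases "D $ i $ j = 0")
      case True
      then show ?thesis using P by (simp add: matrix_nonneg_iff)
    next
      case False
      then have "(i, j) \<in> support D" by (simp add: support_def)
      then have "Min ?E \<le> P $ i $ j / \<bar>D $ i $ j\<bar>" by (intro Min_le[OF fin]) force
      with c have "\<bar>c\<bar> \<le> P $ i $ j / \<bar>D $ i $ j\<bar>" by linarith
      with False have "\<bar>c * D $ i $ j\<bar> \<le> P $ i $ j"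
        by (simp add: field_simps abs_mult)
      then show ?thesis by (simp add: abs_le_iff)
    qed
  qed
  ultimately show thesis using that by blast
qed

lemma lp_feasible_perturbation:
  assumes "(Hp, Hm) \<in> lp_feasible A" "Dp - Dm \<in> two_sided_kernel A"
    and "0 \<le> Hp + c *\<^sub>R Dp" "0 \<le> Hm + c *\<^sub>R Dm"
  shows "(Hp, Hm) + c *\<^sub>R (Dp, Dm) \<in> lp_feasible A"
proof -
  let ?H = "(Hp + c *\<^sub>R Dp) - (Hm + c *\<^sub>R Dm)"
  have H: "?H = (Hp - Hm) + c *\<^sub>R (Dp - Dm)"
    by (simp add: algebra_simps)
  have "A ** ?H = A ** (Hp - Hm)" "?H ** A = (Hp - Hm) ** A"
    using assms(2) unfolding H two_sided_kernel_def
    by (auto simp: matrix_add_ldistrib add_matrix_mul_distrib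
        matrix_scalar_ac simp flip: scalar_matrix_assoc)
  then show ?thesis
    using assms by (simp add: lp_feasible_def)
qed

text \<open>The nonzero entries of \<open>Hp\<close> and \<open>Hm\<close> have room to move in both directions, so small multiples
  of \<open>(Dp, Dm)\<close> and of its negative lead to feasible points.\<close>

lemma lp_extreme_solution_no_direction:
  assumes ext: "lp_extreme_solution A (Hp, Hm)"
    and ker: "Dp - Dm \<in> two_sided_kernel A"
    and sp: "support Dp \<subseteq> support Hp" and sm: "support Dm \<subseteq> support Hm"
  shows "Dp = 0 \<and> Dm = 0"
proof -
  from ext have extr: "(Hp, Hm) extreme_point_of lp_feasible A"
    by (simp add: lp_extreme_solution_def)
  then have feas: "(Hp, Hm) \<in> lp_feasible A"
    by (simp add: extreme_point_of_def)
  then have "0 \<le> Hp" "0 \<le> Hm" by (auto simp: lp_feasible_def)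
  then obtain e1 e2 where "0 < e1" "\<And>c. \<bar>c\<bar> \<le> e1 \<Longrightarrow> 0 \<le> Hp + c *\<^sub>R Dp"
    and "0 < e2" "\<And>c. \<bar>c\<bar> \<le> e2 \<Longrightarrow> 0 \<le> Hm + c *\<^sub>R Dm"
    using ex_nonneg_perturbation[OF _ sp] ex_nonneg_perturbation[OF _ sm] by metis
  then have c: "(Hp, Hm) + c *\<^sub>R (Dp, Dm) \<in> lp_feasible A" if "\<bar>c\<bar> \<le> min e1 e2" for c
    using that by (intro lp_feasible_perturbation[OF feas ker]) auto
  define e where "e = min e1 e2"
  have "0 < e" using \<open>0 < e1\<close> \<open>0 < e2\<close> by (simp add: e_def)
  have "(Hp, Hm) + e *\<^sub>R (Dp, Dm) \<in> lp_feasible A"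
    using c[of e] \<open>0 < e\<close> by (simp add: e_def)
  moreover have "(Hp, Hm) - e *\<^sub>R (Dp, Dm) \<in> lp_feasible A"
    using c[of "- e"] \<open>0 < e\<close> by (simp add: e_def)
  ultimately have "e *\<^sub>R (Dp, Dm) = 0"
    by (rule extreme_point_of_symmetric_perturbation[OF extr])
  then show ?thesis using \<open>0 < e\<close> by (simp add: zero_prod_def)
qed

text \<open>If an entry were positive in both \<open>Hp\<close> and \<open>Hm\<close>, then increasing both by the same amount would
  not change \<open>Hp - Hm\<close>: the direction has difference \<open>0\<close>.\<close>

lemma lp_extreme_solution_disjoint_supports:
  assumes "lp_extreme_solution A (Hp, Hm)"
  shows "support Hp \<inter> support Hm = {}"
proof -
  have False if "(i, j) \<in> support Hp" "(i, j) \<in> support Hm" for i j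
  proof -
    define E :: "real ^ 'b ^ 'a" where "E = axis i (axis j 1)"
    have "support E \<subseteq> {(i, j)}"
      by (auto simp: support_def E_def axis_def split: if_splits)
    moreover have "E - E \<in> two_sided_kernel A"
      by (simp add: two_sided_kernel_def)
    ultimately have "E = 0"
      using lp_extreme_solution_no_direction[OF assms, of E E] that by blast
    then show False by (simp add: E_def axis_eq_0_iff)
  qed
  then show ?thesis by fast
qed

lemma lp_extreme_solution_kernel_support:
  assumes ext: "lp_extreme_solution A (Hp, Hm)"
    and D: "D \<in> two_sided_kernel A" "support D \<subseteq> support Hp \<union> support Hm"
  shows "D = 0"
proof -
  \<comment> \<open>Split \<open>D\<close> into a part carried by \<open>Hp\<close> and a rest, which must be carried by \<open>Hm\<close>.\<close>
  define Dp where "Dp = (\<chi> i j. if (i, j) \<in> support Hp then D $ i $ j else 0)"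
  define Dm where "Dm = Dp - D"
  have "support Dp \<subseteq> support Hp"
    by (auto simp: support_def Dp_def)
  moreover have "support Dm \<subseteq> support Hm"
    using D(2) by (auto simp: support_def Dp_def Dm_def split: if_splits)
  moreover have "Dp - Dm \<in> two_sided_kernel A"
    using D(1) by (simp add: Dm_def)
  ultimately have "Dp = 0 \<and> Dm = 0"
    by (intro lp_extreme_solution_no_direction[OF ext])
  then show ?thesis unfolding Dm_def by auto
qed

section \<open>Counting dimensions\<close>

text \<open>The matrices supported on \<open>S\<close> form a space of dimension \<open>card S\<close>, and subspaces that meet
  trivially have dimensions adding up to at most that of the ambient space.\<close>

lemma card_add_dim_le_if_no_supported:
  fixes K :: "(real ^ 'b ^ 'a) set"
  assumes K: "subspace K"
    and triv: "\<And>D. D \<in> K \<Longrightarrow> support D \<subseteq> S \<Longrightarrow> D = 0"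
  shows "card S + dim K \<le> CARD('a) * CARD('b)"
proof -
  let ?f = "\<lambda>(i, j). axis i (axis j 1) :: real ^ 'b ^ 'a"
  have inj: "inj_on ?f S"
    by (auto simp: inj_on_def axis_eq_axis)
  have "?f ` S \<subseteq> Basis"
    by (auto simp: Basis_vec_def)
  then have dimS: "dim (span (?f ` S)) = card S"
    by (simp add: dim_eq_card_independent independent_substdbasis card_image[OF inj] dim_span)
  have "{D :: real ^ 'b ^ 'a. support D \<subseteq> S} = {D. \<forall>i j. (i, j) \<notin> S \<longrightarrow> D $ i $ j = 0}"
    by (auto simp: support_def)
  then have "subspace {D :: real ^ 'b ^ 'a. support D \<subseteq> S}"
    by (simp add: subspace_def)
  moreover have "?f ` S \<subseteq> {D. support D \<subseteq> S}"
    by (auto simp: support_def axis_def split: if_splits)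
  ultimately have "span (?f ` S) \<subseteq> {D. support D \<subseteq> S}"
    by (rule span_minimal[rotated])
  with triv have "span (?f ` S) \<inter> K \<subseteq> {0}"
    by auto
  then have "dim (span (?f ` S) \<inter> K) = 0"
    by (simp add: dim_eq_0)
  then have "dim {x + y |x y. x \<in> span (?f ` S) \<and> y \<in> K} = card S + dim K"
    using dim_sums_Int[OF subspace_span K, of "?f ` S"] dimS by linarith
  then show ?thesis
    using dim_subset_UNIV[of "{x + y |x y. x \<in> span (?f ` S) \<and> y \<in> K}"]
    by simp
qed

theorem theorem19:
  fixes A :: "real ^ 'n ^ 'm"
    and Hp Hm :: "real ^ 'm ^ 'n"
    and r :: nat
  assumes "rank A = r"
    and "lp_extreme_solution A (Hp, Hm)"
  shows "int (nnz Hp + nnz Hm)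
    \<le> int CARD('m) * int CARD('n) - (int CARD('m) - int r) * (int CARD('n) - int r)"
proof -
  have "nnz Hp + nnz Hm = card (support Hp \<union> support Hm)"
    using lp_extreme_solution_disjoint_supports[OF assms(2)]
    by (simp add: nnz_def card_Un_disjoint flip: support_def)
  moreover have "card (support Hp \<union> support Hm) + dim (two_sided_kernel A) \<le> CARD('n) * CARD('m)"
    using card_add_dim_le_if_no_supported[OF subspace_two_sided_kernel]
      lp_extreme_solution_kernel_support[OF assms(2)] by metis
  ultimately have "nnz Hp + nnz Hm + (CARD('n) - r) * (CARD('m) - r) \<le> CARD('n) * CARD('m)"
    using dim_two_sided_kernel[of A] unfolding assms(1) by linarith
  then have "int (nnz Hp + nnz Hm + (CARD('n) - r) * (CARD('m) - r)) \<le> int (CARD('n) * CARD('m))"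
    by (simp only: of_nat_le_iff)
  \<comment> \<open>The rank is at most both dimensions, so the natural subtractions are exact.\<close>
  moreover have "r \<le> CARD('m)" "r \<le> CARD('n)"
    using rank_bound[of A] assms(1) by auto
  ultimately show ?thesis
    by (simp add: of_nat_diff mult.commute)
qed

end
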